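(* For any constant $\alpha_0<1$, there exists a constant $\varepsilon_0>0$ such that the following holds. Let $N\le 2^{\alpha_0 n}$ be a given parameter. Any two-sided, non-adaptive algorithm (with access to $\mathrm{MQ}(f)$ and $\mathrm{Samp}(f)$) for testing whether an unknown function $f:\{0,1\}^n\to\{0,1\}$ with $|f^{-1}(1)|=\Theta(N)$ is monotone or has relative distance at least $\varepsilon_0$ from every monotone function must make $\tilde{\Omega}(\log N)$ queries.
   Context: For $f,g:\{0,1\}^n\to\{0,1\}$, $\mathrm{rel\text{-}dist}(f,g)=|f^{-1}(1)\triangle g^{-1}(1)|/|f^{-1}(1)|$; the relative distance of $f$ from a class is the minimum over functions in the class. $\mathrm{MQ}(f)$ returns $f(x)$ on query $x$; $\mathrm{Samp}(f)$ returns an independent uniformly random element of $f^{-1}(1)$. A testing algorithm must accept monotone $f$ with probability at least $2/3$ and reject $f$ at relative distance at least $\varepsilon_0$ from monotone with probability at least $2/3$ ("two-sided" means it may err on monotone inputs). "Non-adaptive" means that after receiving all its $\mathrm{Samp}(f)$ responses it makes one parallel round of $\mathrm{MQ}(f)$ queries (which may depend on the samples but not on each other's answers). Queries count calls to both oracles. A function is monotone if $x\preceq y$ coordinatewise implies $f(x)\le f(y)$. *)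

theory Defs
  imports "HOL-Probability.Probability"
begin

text \<open>
  A point of $\{0,1\}^n$ is a function on the coordinates $0,\dots,n-1$, extended by the
  default value, and a Boolean function on $\{0,1\}^n$ is an extensional function on the cube.
  Since \<^const>\<open>extensional\<close> functions agree off their domain, the pointwise order on points of
  the cube is the coordinatewise order, so \<^const>\<open>mono_on\<close> is monotonicity in the usual sense.
\<close>

type_synonym point = "nat \<Rightarrow> bool"

definition cube :: "nat \<Rightarrow> point set" where
  "cube n = {..<n} \<rightarrow>\<^sub>E UNIV"

definition boolean_functions :: "nat \<Rightarrow> (point \<Rightarrow> bool) set" where
  "boolean_functions n = cube n \<rightarrow>\<^sub>E UNIV"

definition monotone_functions :: "nat \<Rightarrow> (point \<Rightarrow> bool) set" where
  "monotone_functions n = {f \<in> boolean_functions n. mono_on (cube n) f}"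

definition ones :: "nat \<Rightarrow> (point \<Rightarrow> bool) \<Rightarrow> point set" where
  "ones n f = {x \<in> cube n. f x}"

definition rel_dist :: "nat \<Rightarrow> (point \<Rightarrow> bool) \<Rightarrow> (point \<Rightarrow> bool) \<Rightarrow> real" where
  "rel_dist n f g = real (card (sym_diff (ones n f) (ones n g))) / real (card (ones n f))"

definition rel_dist_class :: "nat \<Rightarrow> (point \<Rightarrow> bool) \<Rightarrow> (point \<Rightarrow> bool) set \<Rightarrow> real" where
  "rel_dist_class n f C = Min (rel_dist n f ` C)"

text \<open>
  A deterministic non-adaptive algorithm fixes its number of samples, chooses all its membership
  queries from the samples alone, and decides from the samples and the query answers.
  A randomized algorithm is a probability distribution over deterministic ones, so the split of
  the budget between the two oracles may also be random. Discrete distributions lose no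
  generality: for fixed \<open>n\<close> and a bounded number of oracle calls, there are only finitely many
  deterministic algorithms up to their behaviour on inputs from the cube.
\<close>

record det_algorithm =
  num_samples :: nat
  mem_queries :: "point list \<Rightarrow> point list"
  accepts :: "point list \<Rightarrow> bool list \<Rightarrow> bool"

type_synonym algorithm = "det_algorithm pmf"

definition makes_queries_le :: "nat \<Rightarrow> algorithm \<Rightarrow> nat \<Rightarrow> bool" where
  "makes_queries_le n A q \<longleftrightarrow>
     (\<forall>D \<in> set_pmf A. \<forall>xs. length xs = num_samples D \<and> set xs \<subseteq> cube n \<longrightarrow>
        set (mem_queries D xs) \<subseteq> cube n \<and> num_samples D + length (mem_queries D xs) \<le> q)"

text \<open>\<^const>\<open>pmf_of_set\<close> requires a nonempty finite set, so \<open>samp n f\<close> is only meaningful when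
  \<open>f\<close> is not identically false on the cube.\<close>

definition samp :: "nat \<Rightarrow> (point \<Rightarrow> bool) \<Rightarrow> point pmf" where
  "samp n f = pmf_of_set (ones n f)"

definition verdict :: "nat \<Rightarrow> (point \<Rightarrow> bool) \<Rightarrow> algorithm \<Rightarrow> bool pmf" where
  "verdict n f A = do {
     D \<leftarrow> A;
     xs \<leftarrow> replicate_pmf (num_samples D) (samp n f);
     return_pmf (accepts D xs (map f (mem_queries D xs)))
   }"

text \<open>The tester only has to be correct on the inputs in the promise class \<open>F\<close>.\<close>

definition tests_monotonicity ::
    "nat \<Rightarrow> (point \<Rightarrow> bool) set \<Rightarrow> real \<Rightarrow> algorithm \<Rightarrow> bool" where
  "tests_monotonicity n F \<epsilon> A \<longleftrightarrow>
     (\<forall>f \<in> F. f \<in> monotone_functions n \<longrightarrow> pmf (verdict n f A) True \<ge> 2 / 3) \<and>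
     (\<forall>f \<in> F. rel_dist_class n f (monotone_functions n) \<ge> \<epsilon> \<longrightarrow>
        pmf (verdict n f A) False \<ge> 2 / 3)"

end

theory Submission
  imports Defs
begin

text \<open>
  Split off \<open>6k\<close> coordinates, \<open>k\<close> a small multiple of \<open>log N\<close>, into two halves. The zeros of a point
  in the second half (at most two are allowed) form its label, and the zeros in the first half
  form a set \<open>Z\<close> of size at most \<open>k\<close>. Every label \<open>a\<close> hides its own random direction \<open>j\<^sub>a\<close>. Over a label of
  size two, the only values that are not forced are those at the edges \<open>{E - {j\<^sub>a}, E}\<close> with
  \<open>j\<^sub>a \<in> E\<close>, \<open>card E = k\<close>; each edge has a random bit, and the function is constant along
  it in the monotone instance and non-constant in the other one. Two further sign coordinates,
  exactly one of which is 1, negate the values when swapped. Thus one of the two signs makes the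
  edge decreasing in the non-monotone instance, and the number of ones is independent of all
  random choices. Since a constant fraction of the sets of size at most \<open>k\<close> out of \<open>3k\<close> have size
  exactly \<open>k\<close>, the decreasing edges meet a constant fraction of the ones.

  The two mixtures look the same unless both endpoints of an edge in a hidden direction are
  queried. With high probability samples have distinct labels and so reveal little about any \<open>j\<^sub>a\<close>; the
  membership queries are then fixed, and by Bondy's theorem the \<open>m\<close> points queried over \<open>a\<close> span
  edges in fewer than \<open>m\<close> directions, out of \<open>\<Omega>(k)\<close> equally likely ones. Hence \<open>\<Omega>(k)\<close> queries are
  necessary. The remaining coordinates are free or must be 1, which adjusts the number of ones
  to any \<open>N\<close>; the bound has no logarithmic loss, so the exponent of \<open>log (log N)\<close> can be 0.
\<close>

subsection \<open>Reduction to counting\<close>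

lemma pair_pmf_of_set:
  assumes "finite S" "S \<noteq> {}" "finite T" "T \<noteq> {}"
  shows "pair_pmf (pmf_of_set S) (pmf_of_set T) = pmf_of_set (S \<times> T)"
proof (rule pmf_eqI)
  fix x
  show "pmf (pair_pmf (pmf_of_set S) (pmf_of_set T)) x = pmf (pmf_of_set (S \<times> T)) x"
    using assms by (cases x) (auto simp: pmf_pair indicator_def card_cartesian_product)
qed

lemma replicate_pmf_of_set:
  assumes "finite S" "S \<noteq> {}"
  shows "replicate_pmf n (pmf_of_set S) = pmf_of_set {xs. length xs = n \<and> set xs \<subseteq> S}"
proof (induction n)
  case 0
  have "{xs. length xs = 0 \<and> set xs \<subseteq> S} = {[]}" by auto
  then show ?case by (simp add: pmf_of_set_singleton)
next
  case (Suc n)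
  let ?L = "\<lambda>n. {xs. length xs = n \<and> set xs \<subseteq> S}"
  have fin: "finite (?L n)" for n
    using finite_lists_length_eq[OF assms(1), of n] by (simp add: conj_commute)
  obtain s where "s \<in> S" using assms(2) by blast
  then have "replicate n s \<in> ?L n" by auto
  then have ne: "?L n \<noteq> {}" by blast
  have img: "?L (Suc n) = (\<lambda>(x, xs). x # xs) ` (S \<times> ?L n)"
    by (auto simp: length_Suc_conv image_iff)
  have "replicate_pmf (Suc n) (pmf_of_set S)
      = map_pmf (\<lambda>(x, xs). x # xs) (pair_pmf (pmf_of_set S) (pmf_of_set (?L n)))"
    by (simp add: Suc pair_pmf_def map_bind_pmf bind_return_pmf)
  also have "pair_pmf (pmf_of_set S) (pmf_of_set (?L n)) = pmf_of_set (S \<times> ?L n)"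
    by (rule pair_pmf_of_set[OF assms fin ne])
  also have "map_pmf (\<lambda>(x, xs). x # xs) \<dots> = pmf_of_set (?L (Suc n))"
    unfolding img using assms fin ne
    by (subst map_pmf_of_set_inj) (auto intro: inj_onI)
  finally show ?case .
qed

definition accepting_samples ::
    "nat \<Rightarrow> det_algorithm \<Rightarrow> (point \<Rightarrow> bool) \<Rightarrow> point list set" where
  "accepting_samples n D f =
     {xs. length xs = num_samples D \<and> set xs \<subseteq> ones n f \<and> accepts D xs (map f (mem_queries D xs))}"

lemma finite_cube: "finite (cube n)"
  unfolding cube_def by (intro finite_PiE) auto

lemma finite_ones: "finite (ones n f)"
  unfolding ones_def using finite_cube by auto

text \<open>For a fixed deterministic algorithm the samples are uniform over
  \<open>K ^ num_samples D\<close> lists, so acceptance is a ratio of counts.\<close>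

lemma pmf_verdict_True:
  assumes "card (ones n f) = K" "K > 0"
  shows "pmf (verdict n f A) True
    = measure_pmf.expectation A (\<lambda>D. real (card (accepting_samples n D f)) / real K ^ num_samples D)"
proof -
  have ne: "ones n f \<noteq> {}" using assms by auto
  have "pmf (replicate_pmf (num_samples D) (samp n f) \<bind>
      (\<lambda>xs. return_pmf (accepts D xs (map f (mem_queries D xs))))) True
      = real (card (accepting_samples n D f)) / real K ^ num_samples D" for D
  proof -
    let ?L = "{xs. length xs = num_samples D \<and> set xs \<subseteq> ones n f}"
    have fin: "finite ?L"
      using finite_lists_length_eq[OF finite_ones, of n f "num_samples D"] by (simp add: conj_commute)
    have c: "card ?L = K ^ num_samples D"
      using card_lists_length_eq[OF finite_ones, of n f "num_samples D"] assms(1)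
      by (simp add: conj_commute)
    then have Lne: "?L \<noteq> {}" using assms(2) by (metis card.empty power_not_zero less_numeral_extra(3))
    have "pmf (replicate_pmf (num_samples D) (samp n f) \<bind>
      (\<lambda>xs. return_pmf (accepts D xs (map f (mem_queries D xs))))) True
      = pmf (map_pmf (\<lambda>xs. accepts D xs (map f (mem_queries D xs))) (pmf_of_set ?L)) True"
      by (simp add: map_pmf_def samp_def replicate_pmf_of_set[OF finite_ones ne])
    also have "\<dots> = real (card (?L \<inter> {xs. accepts D xs (map f (mem_queries D xs))})) / real (card ?L)"
      by (simp add: pmf_map vimage_def measure_pmf_of_set[OF Lne fin])
    also have "?L \<inter> {xs. accepts D xs (map f (mem_queries D xs))} = accepting_samples n D f"
      by (auto simp: accepting_samples_def)
    finally show ?thesis by (simp add: c)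
  qed
  then show ?thesis unfolding verdict_def by (subst pmf_bind) simp
qed

lemma card_accepting_samples_le:
  assumes "card (ones n f) = K"
  shows "card (accepting_samples n D f) \<le> K ^ num_samples D"
proof -
  have "accepting_samples n D f \<subseteq> {xs. set xs \<subseteq> ones n f \<and> length xs = num_samples D}"
    by (auto simp: accepting_samples_def)
  from card_mono[OF finite_lists_length_eq[OF finite_ones] this] show ?thesis
    by (simp add: card_lists_length_eq[OF finite_ones] assms)
qed

text \<open>Yao's principle: some deterministic algorithm in the support distinguishes the two uniform
  mixtures. All sets of ones having the same size, acceptance probabilities become counts.\<close>

lemma exists_distinguishing_det_algorithm:
  assumes fin: "finite \<Omega>"
    and Y: "\<And>\<omega>. \<omega> \<in> \<Omega> \<Longrightarrow> card (ones n (Y \<omega>)) = K \<and> pmf (verdict n (Y \<omega>) A) True \<ge> 2 / 3"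
    and X: "\<And>\<omega>. \<omega> \<in> \<Omega> \<Longrightarrow> card (ones n (X \<omega>)) = K \<and> pmf (verdict n (X \<omega>) A) False \<ge> 2 / 3"
    and K: "K > 0"
  obtains D where "D \<in> set_pmf A"
    and "(\<Sum>\<omega>\<in>\<Omega>. real (card (accepting_samples n D (Y \<omega>))))
      \<ge> (\<Sum>\<omega>\<in>\<Omega>. real (card (accepting_samples n D (X \<omega>)))) + real (card \<Omega>) / 3 * real K ^ num_samples D"
proof -
  let ?p = "\<lambda>f D. real (card (accepting_samples n D f)) / real K ^ num_samples D"
  have bnd: "\<bar>?p f D\<bar> \<le> 1" if "card (ones n f) = K" for f D
  proof -
    have "real (card (accepting_samples n D f)) \<le> real K ^ num_samples D"
      using card_accepting_samples_le[OF that, of D] by (metis of_nat_le_iff of_nat_power)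
    then show ?thesis using K by simp
  qed
  have int: "integrable (measure_pmf A) (?p f)" if "card (ones n f) = K" for f
    by (rule measure_pmf.integrable_const_bound[where B = 1]) (use bnd[OF that] in auto)
  let ?g = "\<lambda>D. \<Sum>\<omega>\<in>\<Omega>. (?p (Y \<omega>) D - ?p (X \<omega>) D)"
  have "pmf (verdict n f A) True = 1 - pmf (verdict n f A) False" for f
    using pmf_False_conv_True[of "verdict n f A"] by simp
  then have "real (card \<Omega>) * (1 / 3)
      \<le> (\<Sum>\<omega>\<in>\<Omega>. pmf (verdict n (Y \<omega>) A) True - pmf (verdict n (X \<omega>) A) True)"
    using Y X by (intro sum_bounded_below) fastforce
  also have "\<dots> = measure_pmf.expectation A ?g"
    using Y X K by (simp add: pmf_verdict_True int Bochner_Integration.integral_sum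
      Bochner_Integration.integral_diff)
  finally have E: "real (card \<Omega>) / 3 \<le> measure_pmf.expectation A ?g" by simp
  have "\<exists>D\<in>set_pmf A. real (card \<Omega>) / 3 \<le> ?g D"
  proof (rule ccontr)
    assume "\<not> ?thesis"
    then have lt: "?g D < real (card \<Omega>) / 3" if "D \<in> set_pmf A" for D
      using that by (meson not_le)
    have ig: "integrable (measure_pmf A) ?g"
      using Y X by (intro Bochner_Integration.integrable_sum Bochner_Integration.integrable_diff int) auto
    have "measure_pmf.expectation A ?g < real (card \<Omega>) / 3"
      using lt by (intro measure_pmf.expectation_less[OF ig]) (auto simp: AE_measure_pmf_iff)
    then show False using E by simp
  qed
  then obtain D where D: "D \<in> set_pmf A" "real (card \<Omega>) / 3 \<le> ?g D" by blast
  have "?g D = ((\<Sum>\<omega>\<in>\<Omega>. real (card (accepting_samples n D (Y \<omega>)))) - (\<Sum>\<omega>\<in>\<Omega>. real (card (accepting_samples n D (X \<omega>)))))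
     / real K ^ num_samples D"
    by (simp add: sum_subtractf sum_divide_distrib diff_divide_distrib)
  with D K have "(\<Sum>\<omega>\<in>\<Omega>. real (card (accepting_samples n D (Y \<omega>))))
      \<ge> (\<Sum>\<omega>\<in>\<Omega>. real (card (accepting_samples n D (X \<omega>)))) + real (card \<Omega>) / 3 * real K ^ num_samples D"
    by (simp add: pos_le_divide_eq)
  with D that show thesis by blast
qed

subsection \<open>Combinatorial lemmas\<close>

text \<open>These are the directions of the hypercube edges with both endpoints in
  \<open>F\<close>.\<close>

definition directions :: "'a set set \<Rightarrow> 'a set" where
  "directions F = {j. \<exists>Z\<in>F. j \<notin> Z \<and> insert j Z \<in> F}"

text \<open>Bondy's theorem: an edge in direction \<open>j\<close> stays on one side of the cut by any other direction.\<close>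

lemma card_directions_less:
  assumes "finite F" "F \<noteq> {}"
  shows "finite (directions F) \<and> card (directions F) < card F"
  using assms
proof (induction "card F" arbitrary: F rule: less_induct)
  case less
  show ?case
  proof (cases "directions F = {}")
    case True
    with less.prems show ?thesis by (simp add: card_gt_0_iff)
  next
    case False
    then obtain d Z where d: "Z \<in> F" "d \<notin> Z" "insert d Z \<in> F" by (auto simp: directions_def)
    \<comment> \<open>Cutting along an occurring direction leaves both halves nonempty; the two
      strict bounds save 2 in total, and only \<open>d\<close> is added back.\<close>
    let ?F0 = "{Z \<in> F. d \<notin> Z}" and ?F1 = "{Z \<in> F. d \<in> Z}"
    have card: "card F = card ?F0 + card ?F1"
      using less.prems(1) by (subst card_Un_disjoint[symmetric]) (auto intro: arg_cong[where f = card])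
    have ne: "?F0 \<noteq> {}" "?F1 \<noteq> {}" using d by auto
    then have "card ?F0 > 0" "card ?F1 > 0" using less.prems(1) by (auto simp: card_gt_0_iff)
    then have IH: "finite (directions ?F0) \<and> card (directions ?F0) < card ?F0"
      "finite (directions ?F1) \<and> card (directions ?F1) < card ?F1"
      using less.hyps[of ?F0] less.hyps[of ?F1] card ne less.prems(1) by auto
    have sub: "directions F \<subseteq> insert d (directions ?F0 \<union> directions ?F1)"
    proof
      fix j assume "j \<in> directions F"
      then obtain Y where "Y \<in> F" "j \<notin> Y" "insert j Y \<in> F" by (auto simp: directions_def)
      then show "j \<in> insert d (directions ?F0 \<union> directions ?F1)"
        by (cases "d \<in> Y"; cases "j = d") (auto simp: directions_def)
    qed
    have "card (directions F) \<le> card (insert d (directions ?F0 \<union> directions ?F1))"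
      using IH sub by (intro card_mono) auto
    also have "\<dots> \<le> 1 + (card (directions ?F0) + card (directions ?F1))"
      using IH card_Un_le[of "directions ?F0" "directions ?F1"] by (auto simp: card_insert_if)
    finally show ?thesis using IH sub card by (auto intro: finite_subset)
  qed
qed

lemma card_directions_le: "finite F \<Longrightarrow> card (directions F) \<le> card F"
  using card_directions_less[of F] by (cases "F = {}") (auto simp: directions_def)

text \<open>Double counting: replacing the value at \<open>a\<close> by some \<open>i\<close> that
  keeps \<open>Q\<close> sends \<open>(j, i)\<close> injectively to \<open>(j a, j(a := i))\<close>.
  In terms of probability, for positive \<open>t\<close>: given \<open>Q\<close>, the value at
  \<open>a\<close> lies in \<open>D\<close> with probability at most
  \<open>card D / t\<close>.\<close>

lemma resample_count:
  fixes t :: nat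
  assumes "finite M" "finite A" "a \<in> A" "D \<subseteq> M"
    and many: "\<And>j. j \<in> A \<rightarrow>\<^sub>E M \<Longrightarrow> Q j \<Longrightarrow> t \<le> card {i \<in> M. Q (j(a := i))}"
  shows "t * card {j \<in> A \<rightarrow>\<^sub>E M. j a \<in> D \<and> Q j} \<le> card D * card {j \<in> A \<rightarrow>\<^sub>E M. Q j}"
proof -
  let ?S = "{j \<in> A \<rightarrow>\<^sub>E M. j a \<in> D \<and> Q j}" and ?T = "{j \<in> A \<rightarrow>\<^sub>E M. Q j}"
  have finE: "finite (A \<rightarrow>\<^sub>E M)" using assms by (intro finite_PiE) auto
  let ?G = "Sigma ?S (\<lambda>j. {i \<in> M. Q (j(a := i))})"
  have "t * card ?S \<le> (\<Sum>j\<in>?S. card {i \<in> M. Q (j(a := i))})"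
    using many sum_bounded_below[of ?S t "\<lambda>j. card {i \<in> M. Q (j(a := i))}"] by (simp add: mult.commute)
  also have "\<dots> = card ?G" using finE assms by (subst card_SigmaI) auto
  also have "\<dots> \<le> card (D \<times> ?T)"
  proof (rule card_inj_on_le)
    show "inj_on (\<lambda>(j, i). (j a, j(a := i))) ?G"
    proof (intro inj_onI, clarsimp)
      fix j i j' i' assume e: "j a = j' a" "j(a := i) = j'(a := i')"
      have "j = (j(a := i))(a := j a)" "j' = (j'(a := i'))(a := j' a)" by auto
      then show "j = j' \<and> i = i'" using e by (metis fun_upd_same)
    qed
    show "(\<lambda>(j, i). (j a, j(a := i))) ` ?G \<subseteq> D \<times> ?T"
      using assms(3) by (auto simp: PiE_iff extensional_def)
    show "finite (D \<times> ?T)" 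
      using finE finite_subset[OF assms(4,1)] by auto
  qed
  finally show ?thesis by (simp add: card_cartesian_product)
qed

lemma sum_card_swap:
  assumes "finite A" "finite B"
  shows "(\<Sum>a\<in>A. card {b \<in> B. R a b}) = (\<Sum>b\<in>B. card {a \<in> A. R a b})"
  using sum_multicount_gen[OF assms, of R "\<lambda>b. card {a \<in> A. R a b}"] by simp

text \<open>Birthday bound: a list of length \<open>Suc s\<close> fails if its tail does, or if its
  head hits one of the at most \<open>s\<close> labels of the tail; \<open>s\<^sup>2 + s\<close> is
  at most \<open>(Suc s)\<^sup>2\<close>.\<close>

lemma card_repeated_labels_le:
  fixes K B :: nat
  assumes fin: "finite S" and K: "card S = K"
    and fibre: "\<And>l. card {x \<in> S. lab x = l} \<le> B"
  shows "card {xs. length xs = s \<and> set xs \<subseteq> S \<and> \<not> distinct (map lab xs)} * K \<le> s\<^sup>2 * B * K ^ s"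
proof (induction s)
  case 0
  have "{xs. length xs = 0 \<and> set xs \<subseteq> S \<and> \<not> distinct (map lab xs)} = {}" by auto
  then show ?case by (metis card.empty mult_zero_left zero_le)
next
  case (Suc s)
  let ?N = "\<lambda>s. {xs. length xs = s \<and> set xs \<subseteq> S \<and> \<not> distinct (map lab xs)}"
  let ?L = "{xs. set xs \<subseteq> S \<and> length xs = s}"
  have finL: "finite ?L" by (rule finite_lists_length_eq[OF fin])
  have finN: "finite (?N s)" by (rule finite_subset[OF _ finL]) auto
  let ?H = "\<lambda>xs. \<Union>l\<in>lab ` set xs. {x \<in> S. lab x = l}"
  have H: "card (?H xs) \<le> s * B" if "xs \<in> ?L" for xs
  proof -
    have "card (?H xs) \<le> (\<Sum>l\<in>lab ` set xs. card {x \<in> S. lab x = l})"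
      by (rule card_UN_le) auto
    also have "\<dots> \<le> card (lab ` set xs) * B"
      using fibre by (intro sum_bounded_above[where K = B, simplified]) auto
    also have "\<dots> \<le> s * B"
      using card_image_le[of "set xs" lab] card_length[of xs] that by (intro mult_right_mono) auto
    finally show ?thesis .
  qed
  have "?N (Suc s) \<subseteq> (\<lambda>(x, xs). x # xs) ` (S \<times> ?N s) \<union> (\<lambda>(xs, x). x # xs) ` (Sigma ?L ?H)"
    by (auto simp: length_Suc_conv image_iff)
  then have "card (?N (Suc s)) \<le> card ((\<lambda>(x, xs). x # xs) ` (S \<times> ?N s) \<union> (\<lambda>(xs, x). x # xs) ` (Sigma ?L ?H))"
    using fin finN finL by (intro card_mono) auto
  also have "\<dots> \<le> card ((\<lambda>(x, xs). x # xs) ` (S \<times> ?N s)) + card ((\<lambda>(xs, x). x # xs) ` (Sigma ?L ?H))"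
    by (rule card_Un_le)
  also have "\<dots> \<le> card (S \<times> ?N s) + card (Sigma ?L ?H)"
    using fin finN finL by (intro add_mono card_image_le) auto
  also have "card (Sigma ?L ?H) = (\<Sum>xs\<in>?L. card (?H xs))"
    using finL fin by (subst card_SigmaI) auto
  also have "\<dots> \<le> card ?L * (s * B)"
    using H by (intro sum_bounded_above[where K = "s * B", simplified]) auto
  also have "card ?L = K ^ s" by (simp add: card_lists_length_eq[OF fin] K)
  finally have "card (?N (Suc s)) \<le> K * card (?N s) + K ^ s * (s * B)"
    by (simp add: card_cartesian_product K)
  then have "card (?N (Suc s)) * K \<le> (K * card (?N s) + K ^ s * (s * B)) * K"
    by (rule mult_right_mono) simp
  also have "\<dots> = K * (card (?N s) * K) + s * B * K ^ Suc s" by (simp add: algebra_simps)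
  also have "\<dots> \<le> K * (s\<^sup>2 * B * K ^ s) + s * B * K ^ Suc s"
    using Suc by (intro add_mono mult_left_mono) auto
  also have "\<dots> = (s\<^sup>2 + s) * B * K ^ Suc s" by (simp add: algebra_simps)
  also have "\<dots> \<le> (Suc s)\<^sup>2 * B * K ^ Suc s"
    by (intro mult_right_mono) (auto simp: power2_eq_square)
  finally show ?case .
qed

lemma card_bool_pairs:
  "card {(\<sigma>, \<tau>). Q \<sigma> \<tau>} = of_bool (Q True True) + of_bool (Q True False)
     + of_bool (Q False True) + (of_bool (Q False False) :: nat)"
proof -
  have "{(\<sigma>, \<tau>). Q \<sigma> \<tau>} = (if Q True True then {(True, True)} else {}) \<union> (if Q True False then {(True, False)} else {})
     \<union> (if Q False True then {(False, True)} else {}) \<union> (if Q False False then {(False, False)} else {})"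
    by (auto split: if_splits) (metis (full_types))+
  then show ?thesis by simp
qed

text \<open>Up to a third of \<open>card M\<close> each binomial coefficient is at least twice its
  predecessor, so the last one dominates as in a geometric series.\<close>

lemma card_subsets_le_double:
  assumes "finite M" "3 * k \<le> card M"
  shows "card {Z. Z \<subseteq> M \<and> card Z \<le> k} \<le> 2 * (card M choose k)"
  using assms(2)
proof (induction k)
  case 0
  have "{Z. Z \<subseteq> M \<and> card Z \<le> 0} = {{}}" using assms(1) by (auto dest: finite_subset)
  then show ?case by simp
next
  case (Suc k)
  have "{Z. Z \<subseteq> M \<and> card Z \<le> Suc k} = {Z. Z \<subseteq> M \<and> card Z \<le> k} \<union> {Z. Z \<subseteq> M \<and> card Z = Suc k}"
    by auto
  then have "card {Z. Z \<subseteq> M \<and> card Z \<le> Suc k} \<le> 2 * (card M choose k) + (card M choose Suc k)"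
    using card_Un_le[of "{Z. Z \<subseteq> M \<and> card Z \<le> k}" "{Z. Z \<subseteq> M \<and> card Z = Suc k}"] Suc
      n_subsets[OF assms(1), of "Suc k"] by simp
  moreover have "2 * (card M choose k) \<le> (card M choose Suc k)"
  proof -
    have "Suc k * (card M choose Suc k) = (card M - k) * (card M choose k)"
      using binomial_absorb_comp[of "card M" k] binomial_absorption[of k "card M"] Suc.prems
      by (simp add: mult.commute)
    also have "\<dots> \<ge> (2 * Suc k) * (card M choose k)"
      using Suc.prems by (intro mult_right_mono) auto
    finally have "Suc k * (2 * (card M choose k)) \<le> Suc k * (card M choose Suc k)" by (simp add: ac_simps)
    then show ?thesis by (metis Suc_mult_le_cancel1)
  qed
  ultimately show ?case by simp
qed

lemma card_subsets_containing:
  assumes "finite M" "j \<in> M" "k > 0"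
  shows "card M * card {E. E \<subseteq> M \<and> card E = k \<and> j \<in> E} = k * (card M choose k)"
proof -
  have "bij_betw (insert j) {E. E \<subseteq> M - {j} \<and> card E = k - 1} {E. E \<subseteq> M \<and> card E = k \<and> j \<in> E}"
  proof (rule bij_betw_byWitness[where f' = "\<lambda>E. E - {j}"])
    show "insert j ` {E. E \<subseteq> M - {j} \<and> card E = k - 1} \<subseteq> {E. E \<subseteq> M \<and> card E = k \<and> j \<in> E}"
      using assms finite_subset[of _ "M - {j}"] by (auto simp: card_insert_if)
  qed (use assms in \<open>auto simp: card_Diff_singleton_if\<close>)
  then have "card {E. E \<subseteq> M \<and> card E = k \<and> j \<in> E} = (card M - 1) choose (k - 1)"
    using n_subsets[of "M - {j}" "k - 1"] assms by (simp add: bij_betw_same_card[symmetric])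
  moreover have "card M > 0" using assms by (auto simp: card_gt_0_iff)
  ultimately show ?thesis
    using binomial_absorption[of "k - 1" "card M"] assms(3) by simp
qed

subsection \<open>The hard instances\<close>

definition zeros :: "nat set \<Rightarrow> point \<Rightarrow> nat set" where
  "zeros I x = {i \<in> I. \<not> x i}"

text \<open>\<open>core\<close> is the part of the function over one label: \<open>j\<close> is the hidden direction, \<open>c\<close> the set of
  edges, named by their larger set \<open>E\<close>, whose bit is set, \<open>\<sigma>\<close> the sign, and \<open>b\<close> selects the monotone instance. \<open>Z\<close> is a set
  of zeros, so \<open>E\<close> is the lower endpoint in the cube.\<close>

definition core :: "nat \<Rightarrow> bool \<Rightarrow> nat \<Rightarrow> nat set set \<Rightarrow> nat set \<Rightarrow> bool \<Rightarrow> bool" where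
  "core k b j c Z \<sigma> \<longleftrightarrow> card Z + 2 \<le> k \<or> card Z + 1 = k \<and> j \<in> Z \<or>
     card (insert j Z) = k \<and> (insert j Z \<in> c \<longleftrightarrow> (\<sigma> \<longleftrightarrow> b \<or> j \<in> Z))"

text \<open>Sizes up to \<open>k - 2\<close> are forced to be true. So only
  \<open>card Z = k\<close> with \<open>card Z' = k - 1\<close> matters, where \<open>j\<close> is
  in \<open>Z\<close>: either \<open>j\<close> is in \<open>Z'\<close> and its value is forced, or
  \<open>Z'\<close> is the other endpoint of the edge of \<open>Z\<close> and has the same
  value.\<close>

lemma core_True_antimono:
  assumes "core k True j c Z \<sigma>" "Z' \<subseteq> Z" "finite Z" "k \<ge> 1"
  shows "core k True j c Z' \<sigma>"
proof (cases "Z' = Z")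
  case False
  then have lt: "card Z' < card Z" using assms by (intro psubset_card_mono) auto
  have fin': "finite Z'" using assms finite_subset by blast
  show ?thesis
  proof (cases "card Z' + 2 \<le> k")
    case small: False
    then have "card Z = k" "card Z' + 1 = k" "j \<in> Z" "Z \<in> c \<longleftrightarrow> \<sigma>"
      using assms lt by (auto simp: core_def card_insert_if insert_absorb split: if_splits)
    moreover have "insert j Z' = Z" if "j \<notin> Z'"
      using that calculation assms fin' by (intro card_subset_eq) auto
    ultimately show ?thesis by (auto simp: core_def)
  qed (simp add: core_def)
qed (use assms in simp)

text \<open>Smaller labels and the sign pair (True, True) are filled with ones. Points governed by
  \<open>core\<close> are thus comparable only if they share label and signs, and no constraint
  links different hidden directions.\<close>

definition rule ::
    "nat \<Rightarrow> bool \<Rightarrow> (nat set \<Rightarrow> nat) \<Rightarrow> (nat set \<times> nat set) set \<Rightarrow> nat set \<Rightarrow> nat set \<Rightarrow> bool \<Rightarrow> bool \<Rightarrow> bool" where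
  "rule k b j C a Z \<sigma> \<tau> \<longleftrightarrow> card a \<le> 2 \<and> card Z \<le> k \<and> (\<sigma> \<or> \<tau>) \<and>
     (card a < 2 \<or> \<sigma> \<and> \<tau> \<or> core k b (j a) (C `` {a}) Z \<sigma>)"

text \<open>Moving up either reaches the filled region or keeps label and signs, where
  \<open>core_True_antimono\<close> applies.\<close>

lemma rule_True_antimono:
  assumes "rule k True j C a Z \<sigma> \<tau>" "a' \<subseteq> a" "Z' \<subseteq> Z" "finite a" "finite Z" "k \<ge> 1"
    "\<sigma> \<le> \<sigma>'" "\<tau> \<le> \<tau>'"
  shows "rule k True j C a' Z' \<sigma>' \<tau>'"
proof -
  have le: "card a' \<le> card a" "card Z' \<le> card Z" using assms by (auto intro: card_mono)
  show ?thesis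
  proof (cases "card a' < 2 \<or> \<sigma>' \<and> \<tau>'")
    case True
    then show ?thesis using le assms by (auto simp: rule_def)
  next
    case False
    then have "card a' = card a" using le assms by (auto simp: rule_def)
    then have "a' = a" using assms by (intro card_subset_eq) auto
    moreover have "\<sigma>' = \<sigma>" "\<tau>' = \<tau>" using False assms by (auto simp: rule_def)
    ultimately show ?thesis using assms False le core_True_antimono[of k "j a" "C `` {a}" Z \<sigma> Z']
      by (auto simp: rule_def)
  qed
qed

text \<open>At an edge endpoint swapping the signs negates \<open>core\<close>, so exactly one of
  the two mixed sign pairs counts, whatever \<open>C\<close> and \<open>b\<close> are.\<close>

lemma card_rule_signs:
  assumes "card a = 2" "finite Z"
  shows "card {(\<sigma>, \<tau>). rule k b j C a Z \<sigma> \<tau>} =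
    (if card Z > k then 0
     else if card Z + 2 \<le> k \<or> card Z + 1 = k \<and> j a \<in> Z then 3
     else if card (insert (j a) Z) = k then 2 else 1)"
  unfolding card_bool_pairs rule_def core_def using assms by auto

section \<open>Coordinates of the cube and their decomposition\<close>

locale hidden_directions =
  fixes n k r :: nat
  assumes k: "2 \<le> k" and dim: "6 * k + 2 + r \<le> n"
begin

definition M :: "nat set" where "M = {..<3 * k}"
definition P :: "nat set" where "P = {3 * k..<6 * k}"
definition free :: "nat set" where "free = {6 * k + 2..<6 * k + 2 + r}"
text \<open>Only labels of size two carry a hidden direction and edge bits.\<close>

definition labels :: "nat set set" where "labels = {a. a \<subseteq> P \<and> card a = 2}"
definition tops :: "nat set set" where "tops = {E. E \<subseteq> M \<and> card E = k}"
definition params :: "((nat set \<Rightarrow> nat) \<times> (nat set \<times> nat set) set) set" where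
  "params = (labels \<rightarrow>\<^sub>E M) \<times> Pow (labels \<times> tops)"

definition base :: "point set" where
  "base = {x \<in> cube n. \<forall>i\<in>{6 * k + 2 + r..<n}. x i}"

definition hard :: "bool \<Rightarrow> (nat set \<Rightarrow> nat) \<Rightarrow> (nat set \<times> nat set) set \<Rightarrow> point \<Rightarrow> bool" where
  "hard b j C = (\<lambda>x\<in>cube n. x \<in> base \<and>
     rule k b j C (zeros P x) (zeros M x) (x (6 * k)) (x (6 * k + 1)))"

definition point_of :: "nat set \<Rightarrow> nat set \<Rightarrow> bool \<Rightarrow> bool \<Rightarrow> nat set \<Rightarrow> point" where
  "point_of a Z \<sigma> \<tau> \<rho> = (\<lambda>i\<in>{..<n}. if i = 6 * k then \<sigma> else if i = 6 * k + 1 then \<tau> else i \<notin> a \<union> Z \<union> \<rho>)"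

lemma finite_sets [simp]: "finite M" "finite P" "finite free" "finite labels" "finite tops" "finite params"
proof -
  show fin: "finite M" "finite P" "finite free" by (simp_all add: M_def P_def free_def)
  show fin': "finite labels" "finite tops"
    using fin by (auto simp: labels_def tops_def)
  show "finite params" unfolding params_def using fin fin' by (intro finite_cartesian_product finite_PiE) auto
qed

lemma card_M: "card M = 3 * k" and card_P: "card P = 3 * k" and card_free: "card free = r"
  by (simp_all add: M_def P_def free_def)

lemma card_labels: "card labels = (3 * k) choose 2"
  unfolding labels_def by (simp add: n_subsets card_P)

lemma card_tops: "card tops = (3 * k) choose k"
  unfolding tops_def by (simp add: n_subsets card_M)

lemma zeros_subset [simp]: "zeros I x \<subseteq> I" and finite_zeros: "finite I \<Longrightarrow> finite (zeros I x)"
  by (auto simp: zeros_def)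

lemma ones_hard:
  "ones n (hard b j C) = {x \<in> base. rule k b j C (zeros P x) (zeros M x) (x (6 * k)) (x (6 * k + 1))}"
  by (auto simp: ones_def hard_def base_def)

lemma hard_in_boolean_functions: "hard b j C \<in> boolean_functions n"
  unfolding hard_def boolean_functions_def by auto

lemma point_of:
  assumes "a \<subseteq> P" "Z \<subseteq> M" "\<rho> \<subseteq> free"
  shows "point_of a Z \<sigma> \<tau> \<rho> \<in> base" "zeros P (point_of a Z \<sigma> \<tau> \<rho>) = a" "zeros M (point_of a Z \<sigma> \<tau> \<rho>) = Z"
    "zeros free (point_of a Z \<sigma> \<tau> \<rho>) = \<rho>" "point_of a Z \<sigma> \<tau> \<rho> (6 * k) = \<sigma>"
    "point_of a Z \<sigma> \<tau> \<rho> (6 * k + 1) = \<tau>"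
  using assms dim
  unfolding base_def cube_def point_of_def zeros_def M_def P_def free_def
  by (auto simp: subset_iff)

lemma point_of_zeros:
  assumes "x \<in> base"
  shows "point_of (zeros P x) (zeros M x) (x (6 * k)) (x (6 * k + 1)) (zeros free x) = x"
proof
  fix i
  have ext: "x i = undefined" if "\<not> i < n"
    using assms that unfolding base_def cube_def by (auto simp: PiE_iff extensional_def)
  consider "i \<in> M" | "i \<in> P" | "i = 6 * k" | "i = 6 * k + 1" | "i \<in> free" | "i \<in> {6 * k + 2 + r..<n}" | "\<not> i < n"
    using dim unfolding M_def P_def free_def by fastforce
  then show "point_of (zeros P x) (zeros M x) (x (6 * k)) (x (6 * k + 1)) (zeros free x) i = x i"
    using assms dim ext unfolding point_of_def
    by cases (auto simp: zeros_def M_def P_def free_def base_def)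
qed

lemma mono_point_of:
  assumes "\<rho> \<subseteq> free" "a \<subseteq> P" "Z \<subseteq> M" "Z' \<subseteq> Z"
  shows "point_of a Z \<sigma> \<tau> \<rho> \<le> point_of a Z' \<sigma> \<tau> \<rho>"
  using assms unfolding point_of_def by (auto simp: le_fun_def)

text \<open>The free zeros are separated from the data seen by \<open>rule\<close>, so that they
  contribute a plain factor \<open>2 ^ r\<close> to every count.\<close>

definition signature :: "point \<Rightarrow> (nat set \<times> nat set \<times> bool \<times> bool) \<times> nat set" where
  "signature x = ((zeros P x, zeros M x, x (6 * k), x (6 * k + 1)), zeros free x)"

lemma inj_on_signature: "inj_on signature base"
  by (rule inj_on_inverseI[where g = "\<lambda>((a, Z, \<sigma>, \<tau>), \<rho>). point_of a Z \<sigma> \<tau> \<rho>"])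
     (use point_of_zeros in \<open>simp add: signature_def\<close>)

lemma card_by_signature:
  assumes "\<And>a Z \<sigma> \<tau>. (a, Z, \<sigma>, \<tau>) \<in> T \<Longrightarrow> a \<subseteq> P \<and> Z \<subseteq> M"
  shows "card {x \<in> base. (zeros P x, zeros M x, x (6 * k), x (6 * k + 1)) \<in> T} = card T * 2 ^ r"
proof -
  have "signature ` {x \<in> base. (zeros P x, zeros M x, x (6 * k), x (6 * k + 1)) \<in> T} = T \<times> Pow free"
  proof (intro equalityI subsetI)
    fix y assume "y \<in> T \<times> Pow free"
    then obtain a Z \<sigma> \<tau> \<rho> where y: "y = ((a, Z, \<sigma>, \<tau>), \<rho>)" "(a, Z, \<sigma>, \<tau>) \<in> T" "\<rho> \<subseteq> free" by auto
    with assms have "a \<subseteq> P" "Z \<subseteq> M" by auto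
    with y show "y \<in> signature ` {x \<in> base. (zeros P x, zeros M x, x (6 * k), x (6 * k + 1)) \<in> T}"
      by (intro image_eqI[where x = "point_of a Z \<sigma> \<tau> \<rho>"]) (auto simp: signature_def point_of simp del: One_nat_def)
  qed (auto simp: signature_def zeros_def)
  moreover have "inj_on signature {x \<in> base. (zeros P x, zeros M x, x (6 * k), x (6 * k + 1)) \<in> T}"
    by (rule inj_on_subset[OF inj_on_signature]) auto
  ultimately show ?thesis
    using card_image[of signature "{x \<in> base. (zeros P x, zeros M x, x (6 * k), x (6 * k + 1)) \<in> T}"]
    by (simp add: card_cartesian_product card_Pow card_free)
qed

section \<open>Counting the ones of the instances\<close>

definition rule_set ::
    "bool \<Rightarrow> (nat set \<Rightarrow> nat) \<Rightarrow> (nat set \<times> nat set) set \<Rightarrow> (nat set \<times> nat set \<times> bool \<times> bool) set" where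
  "rule_set b j C = {(a, Z, \<sigma>, \<tau>). a \<subseteq> P \<and> Z \<subseteq> M \<and> rule k b j C a Z \<sigma> \<tau>}"

lemma ones_hard_eq:
  "ones n (hard b j C) = {x \<in> base. (zeros P x, zeros M x, x (6 * k), x (6 * k + 1)) \<in> rule_set b j C}"
  unfolding ones_hard rule_set_def by auto

lemma card_ones_hard: "card (ones n (hard b j C)) = card (rule_set b j C) * 2 ^ r"
  unfolding ones_hard_eq by (rule card_by_signature) (auto simp: rule_set_def)

lemma rule_set_Sigma:
  "rule_set b j C = Sigma (Pow P) (\<lambda>a. Sigma (Pow M) (\<lambda>Z. {(\<sigma>, \<tau>). rule k b j C a Z \<sigma> \<tau>}))"
  by (auto simp: rule_set_def)

text \<open>By \<open>card_rule_signs\<close> the count depends only on sizes and on membership of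
  the hidden direction; the transposition of the two directions permutes the zero sets and preserves
  both.\<close>

lemma sum_card_rule_signs_eq:
  assumes "card a = 2" "j a \<in> M" "j' a \<in> M"
  shows "(\<Sum>Z\<in>Pow M. card {(\<sigma>, \<tau>). rule k b j C a Z \<sigma> \<tau>}) = (\<Sum>Z\<in>Pow M. card {(\<sigma>, \<tau>). rule k b' j' C' a Z \<sigma> \<tau>})"
proof -
  define t where "t = Transposition.transpose (j a) (j' a)"
  have inj: "inj t" by (simp add: t_def)
  have tM: "t ` M = M" using assms by (auto simp: t_def transpose_def image_iff split: if_splits)
  have bij: "bij_betw (image t) (Pow M) (Pow M)"
    using bij_betw_Pow[of t M M] inj tM by (simp add: bij_betw_def inj_on_def)
  have "(\<Sum>Z\<in>Pow M. card {(\<sigma>, \<tau>). rule k b' j' C' a Z \<sigma> \<tau>}) =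
      (\<Sum>Z\<in>Pow M. card {(\<sigma>, \<tau>). rule k b' j' C' a (t ` Z) \<sigma> \<tau>})"
    by (rule sum.reindex_bij_betw[OF bij, symmetric])
  also have "\<dots> = (\<Sum>Z\<in>Pow M. card {(\<sigma>, \<tau>). rule k b j C a Z \<sigma> \<tau>})"
  proof (rule sum.cong[OF refl])
    fix Z assume "Z \<in> Pow M"
    then have fin: "finite Z" "finite (t ` Z)" using finite_subset[OF _ finite_sets(1)] by auto
    have tj: "j' a = t (j a)" by (simp add: t_def)
    have "card (t ` Z) = card Z" using inj by (simp add: card_image inj_on_def)
    moreover have "j' a \<in> t ` Z \<longleftrightarrow> j a \<in> Z" unfolding tj using inj by (simp add: inj_image_mem_iff)
    moreover have "card (insert (j' a) (t ` Z)) = card (insert (j a) Z)"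
      unfolding tj image_insert[symmetric] by (rule card_image[OF inj_on_subset[OF inj]]) simp
    ultimately show "card {(\<sigma>, \<tau>). rule k b' j' C' a (t ` Z) \<sigma> \<tau>} = card {(\<sigma>, \<tau>). rule k b j C a Z \<sigma> \<tau>}"
      using card_rule_signs[OF assms(1) fin(1)] card_rule_signs[OF assms(1) fin(2)] by simp
  qed
  finally show ?thesis by simp
qed

text \<open>Labels of other sizes do not see the parameters. Equal numbers of ones give all
  instances the same denominator, so that acceptance counts can be compared.\<close>

lemma card_ones_hard_const:
  assumes "j \<in> labels \<rightarrow>\<^sub>E M" "j' \<in> labels \<rightarrow>\<^sub>E M"
  shows "card (ones n (hard b j C)) = card (ones n (hard b' j' C'))"
proof -
  have fin: "finite {(\<sigma> :: bool, \<tau> :: bool). Q \<sigma> \<tau>}" for Q by (rule finite_subset[OF subset_UNIV]) simp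
  have "card (rule_set b j C) = (\<Sum>a\<in>Pow P. \<Sum>Z\<in>Pow M. card {(\<sigma>, \<tau>). rule k b j C a Z \<sigma> \<tau>})" for b j C
    unfolding rule_set_Sigma using fin by (subst card_SigmaI; simp)+
  moreover have "(\<Sum>Z\<in>Pow M. card {(\<sigma>, \<tau>). rule k b j C a Z \<sigma> \<tau>}) = (\<Sum>Z\<in>Pow M. card {(\<sigma>, \<tau>). rule k b' j' C' a Z \<sigma> \<tau>})"
    if "a \<in> Pow P" for a
  proof (cases "card a = 2")
    case True
    then have "a \<in> labels" using that by (simp add: labels_def)
    with assms show ?thesis by (intro sum_card_rule_signs_eq[OF True]) auto
  next
    case False
    have "rule k b j C a Z \<sigma> \<tau> = rule k b' j' C' a Z \<sigma> \<tau>" for Z \<sigma> \<tau>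
      using False by (auto simp: rule_def)
    then show ?thesis by simp
  qed
  ultimately show ?thesis by (simp add: card_ones_hard)
qed

lemma card_small_sets:
  "card {a. a \<subseteq> P \<and> card a \<le> 2} \<le> 2 * card labels" "card {Z. Z \<subseteq> M \<and> card Z \<le> k} \<le> 2 * card tops"
  using card_subsets_le_double[of P 2] card_subsets_le_double[of M k] k
  by (simp_all add: card_P card_M card_labels card_tops)

lemma card_signs: "card {(\<sigma>, \<tau>). \<sigma> \<or> \<tau>} = 3"
  by (simp add: card_bool_pairs)

lemma finite_base: "finite base" using finite_cube by (auto simp: base_def)

lemma card_ones_hard_ge: "card (ones n (hard b j C)) \<ge> card labels * card tops * 2 ^ r"
proof -
  have fin: "finite (rule_set b j C)" unfolding rule_set_Sigma
    by (intro finite_SigmaI) (auto intro: finite_subset[OF subset_UNIV])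
  have "labels \<times> tops \<times> {(True, True)} \<subseteq> rule_set b j C"
    by (auto simp: labels_def tops_def rule_set_def rule_def)
  from card_mono[OF fin this] show ?thesis
    unfolding card_ones_hard by (intro mult_right_mono) (simp_all add: card_cartesian_product)
qed

lemma card_ones_hard_le: "card (ones n (hard b j C)) \<le> 12 * (card labels * card tops * 2 ^ r)"
proof -
  let ?T = "{a. a \<subseteq> P \<and> card a \<le> 2} \<times> {Z. Z \<subseteq> M \<and> card Z \<le> k} \<times> {(\<sigma>, \<tau>). \<sigma> \<or> \<tau>}"
  have "finite ?T" by (intro finite_cartesian_product) (auto intro: finite_subset[OF subset_UNIV])
  moreover have "rule_set b j C \<subseteq> ?T" by (auto simp: rule_set_def rule_def)
  ultimately have "card (rule_set b j C) \<le> card ?T" by (intro card_mono)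
  \<comment> \<open>The constant 12 is 2 for the small labels, 2 for the small zero sets and 3 for
    the sign pairs.\<close>
  also have "\<dots> \<le> (2 * card labels) * ((2 * card tops) * 3)"
    unfolding card_cartesian_product card_signs by (intro mult_mono card_small_sets) auto
  finally show ?thesis unfolding card_ones_hard by simp
qed

text \<open>With \<open>card_ones_hard_ge\<close>, a single label carries at most the fraction
  \<open>6 / card labels\<close> of the ones, as the birthday bound requires.\<close>

lemma card_label_fibre_le: "card {x \<in> ones n (hard b j C). zeros P x = a} \<le> 6 * card tops * 2 ^ r"
proof (cases "a \<subseteq> P")
  case True
  let ?T = "{a} \<times> {Z. Z \<subseteq> M \<and> card Z \<le> k} \<times> {(\<sigma>, \<tau>). \<sigma> \<or> \<tau>}"
  have "card {x \<in> ones n (hard b j C). zeros P x = a}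
      \<le> card {x \<in> base. (zeros P x, zeros M x, x (6 * k), x (6 * k + 1)) \<in> ?T}"
    using finite_base by (intro card_mono) (auto simp: ones_hard rule_def simp del: One_nat_def)
  also have "\<dots> = card ?T * 2 ^ r" by (rule card_by_signature) (use True in auto)
  also have "card ?T \<le> 1 * ((2 * card tops) * 3)"
    unfolding card_cartesian_product card_signs by (intro mult_mono card_small_sets) auto
  finally show ?thesis by simp
next
  case False
  then have "{x \<in> ones n (hard b j C). zeros P x = a} = {}" by (auto simp: zeros_def)
  then show ?thesis by (metis card.empty zero_le)
qed

section \<open>Monotonicity and distance from monotonicity\<close>

lemma hard_monotone: "hard True j C \<in> monotone_functions n"
proof -
  have "mono_on (cube n) (hard True j C)"
  proof (rule mono_onI)
    fix x y assume xy: "x \<in> cube n" "y \<in> cube n" "x \<le> y"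
    have le: "x i \<le> y i" for i using xy by (simp add: le_fun_def)
    have "hard True j C y" if "hard True j C x"
    proof -
      from that xy(1) have x: "x \<in> base" "rule k True j C (zeros P x) (zeros M x) (x (6 * k)) (x (6 * k + 1))"
        by (simp_all add: hard_def)
      have "zeros I y \<subseteq> zeros I x" for I using le by (auto simp: zeros_def)
      then have "rule k True j C (zeros P y) (zeros M y) (y (6 * k)) (y (6 * k + 1))"
        using k le by (intro rule_True_antimono[OF x(2)]) (simp_all add: finite_zeros)
      moreover have "y \<in> base" using x(1) xy(2) le unfolding base_def by auto
      ultimately show ?thesis using xy(2) by (simp add: hard_def)
    qed
    then show "hard True j C x \<le> hard True j C y" by auto
  qed
  then show ?thesis using hard_in_boolean_functions by (simp add: monotone_functions_def)
qed

text \<open>Every edge, for each choice of the free coordinates, yields a decreasing pair, on which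
  a monotone \<open>g\<close> must differ from the instance; these pairs are disjoint.\<close>

lemma card_sym_diff_hard_False_ge:
  assumes j: "j \<in> labels \<rightarrow>\<^sub>E M" and g: "g \<in> monotone_functions n"
  shows "card labels * card tops * 2 ^ r \<le> 3 * card (sym_diff (ones n (hard False j C)) (ones n g))"
proof -
  let ?f = "hard False j C"
  let ?D = "sym_diff (ones n ?f) (ones n g)"
  let ?E = "\<lambda>a. {E. E \<subseteq> M \<and> card E = k \<and> j a \<in> E}"
  let ?V = "Sigma labels ?E \<times> Pow free"
  \<comment> \<open>Both endpoints decode to the same edge, so surjectivity onto \<open>?V\<close>
    counts disjoint pairs.\<close>
  let ?dec = "\<lambda>x. ((zeros P x, insert (j (zeros P x)) (zeros M x)), zeros free x)"
  have "?V \<subseteq> ?dec ` ?D"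
  proof
    fix v assume "v \<in> ?V"
    then obtain a E \<rho> where v: "v = ((a, E), \<rho>)" "a \<in> labels" "E \<subseteq> M" "card E = k" "j a \<in> E" "\<rho> \<subseteq> free"
      by auto
    \<comment> \<open>The sign matches the bit of the edge, which makes the lower endpoint
      \<open>x\<close> a one and the upper endpoint \<open>y\<close> a zero.\<close>
    define \<sigma> where "\<sigma> \<longleftrightarrow> (a, E) \<in> C"
    define x where "x = point_of a E \<sigma> (\<not> \<sigma>) \<rho>"
    define y where "y = point_of a (E - {j a}) \<sigma> (\<not> \<sigma>) \<rho>"
    have a: "a \<subseteq> P" "card a = 2" using v by (auto simp: labels_def)
    have E: "finite E" by (rule finite_subset[OF v(3)]) simp
    have "E - {j a} \<subseteq> M" using v by auto
    note px = point_of[OF a(1) v(3,6), of \<sigma> "\<not> \<sigma>", folded x_def]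
      and py = point_of[OF a(1) this v(6), of \<sigma> "\<not> \<sigma>", folded y_def]
    have xy: "x \<le> y" unfolding x_def y_def by (rule mono_point_of) (use v a in auto)
    have dx: "?dec x = v" and dy: "?dec y = v"
      using px py v by (auto simp: insert_absorb)
    have "x \<in> ones n ?f"
      using px a v k E by (auto simp: ones_hard rule_def core_def insert_absorb \<sigma>_def)
    moreover have "y \<notin> ones n ?f"
      using py a v k E by (auto simp: ones_hard rule_def core_def insert_absorb \<sigma>_def)
    moreover have "x \<in> ones n g \<Longrightarrow> y \<in> ones n g"
      using g xy px(1) py(1) mono_onD[of "cube n" g x y]
      by (auto simp: monotone_functions_def ones_def base_def)
    ultimately have "x \<in> ?D \<or> y \<in> ?D" by auto
    then show "v \<in> ?dec ` ?D" using dx dy by (metis (no_types, lifting) image_eqI)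
  qed
  moreover have "finite ?D" using finite_ones by auto
  ultimately have "card ?V \<le> card ?D" by (rule surj_card_le[rotated])
  moreover have "3 * card ?V = card labels * card tops * 2 ^ r"
  proof -
    \<comment> \<open>Since \<open>card M = 3 * k\<close>, a fixed element lies in a third of the
      \<open>k\<close>-subsets.\<close>
    have "3 * card (?E a) = card tops" if "a \<in> labels" for a
    proof -
      have "j a \<in> M" using j that by auto
      from card_subsets_containing[OF _ this, of k] k have "k * (3 * card (?E a)) = k * card tops"
        by (simp add: card_M card_tops ac_simps)
      then show ?thesis using k by simp
    qed
    then have "3 * card (Sigma labels ?E) = card labels * card tops"
      by (subst card_SigmaI) (auto simp: sum_distrib_left)
    then show ?thesis by (simp add: card_cartesian_product card_Pow card_free mult.assoc[symmetric])
  qed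
  ultimately show ?thesis by linarith
qed

text \<open>36 is 12 from the upper bound on the number of ones times 3 from the count of decreasing
  pairs.\<close>

lemma rel_dist_hard_False_ge:
  assumes "j \<in> labels \<rightarrow>\<^sub>E M"
  shows "rel_dist_class n (hard False j C) (monotone_functions n) \<ge> 1 / 36"
proof -
  have "finite (boolean_functions n)"
    unfolding boolean_functions_def using finite_cube by (intro finite_PiE) auto
  then have fin: "finite (monotone_functions n)" by (simp add: monotone_functions_def)
  have ne: "monotone_functions n \<noteq> {}" using hard_monotone by blast
  have "rel_dist n (hard False j C) g \<ge> 1 / 36" if g: "g \<in> monotone_functions n" for g
  proof -
    let ?D = "card (sym_diff (ones n (hard False j C)) (ones n g))" and ?K = "card (ones n (hard False j C))"
    have "?K \<le> 36 * ?D"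
      using card_sym_diff_hard_False_ge[OF assms g, of C] card_ones_hard_le[of False j C] by linarith
    moreover have "card labels > 0" "card tops > 0"
      using k by (simp_all add: card_labels card_tops)
    then have "?K > 0" using card_ones_hard_ge[of False j C]
      by (metis less_le_trans mult_pos_pos zero_less_numeral zero_less_power)
    ultimately show ?thesis by (simp add: rel_dist_def field_simps)
  qed
  then show ?thesis unfolding rel_dist_class_def using fin ne by (intro Min.boundedI) auto
qed

subsection \<open>Indistinguishability\<close>

definition queried_zeros :: "point set \<Rightarrow> nat set \<Rightarrow> nat set set" where
  "queried_zeros W a = {zeros M w | w. w \<in> W \<and> zeros P w = a}"

text \<open>Edges of all levels count here, not only those that carry a bit, so that Bondy's theorem
  applies directly.\<close>

definition exposed :: "point set \<Rightarrow> (nat set \<Rightarrow> nat) \<Rightarrow> bool" where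
  "exposed W j \<longleftrightarrow> (\<exists>a\<in>labels. j a \<in> directions (queried_zeros W a))"

definition flips :: "point set \<Rightarrow> (nat set \<Rightarrow> nat) \<Rightarrow> (nat set \<times> nat set) set" where
  "flips W j = {(a, E) \<in> labels \<times> tops. j a \<in> E \<and> E - {j a} \<in> queried_zeros W a}"

text \<open>Flipping the random bit of every edge whose upper endpoint is queried turns the monotone
  instance into the non-monotone one, as long as no edge has both endpoints queried.\<close>

lemma hard_eq_flipped:
  assumes j: "j \<in> labels \<rightarrow>\<^sub>E M" and W: "W \<subseteq> cube n" "\<not> exposed W j" and w: "w \<in> W"
  shows "hard True j C w = hard False j (sym_diff C (flips W j)) w"
proof -
  let ?a = "zeros P w" and ?Z = "zeros M w"
  let ?E = "insert (j ?a) ?Z"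
  have "core k True (j ?a) (C `` {?a}) ?Z \<sigma> = core k False (j ?a) (sym_diff C (flips W j) `` {?a}) ?Z \<sigma>"
    if "card ?a = 2" for \<sigma>
  proof (cases "card ?E = k")
    case True
    have a: "?a \<in> labels" using that by (simp add: labels_def)
    then have E: "?E \<in> tops" using True j by (auto simp: tops_def zeros_def)
    have Z: "?Z \<in> queried_zeros W ?a" using w by (auto simp: queried_zeros_def)
    have no: "j ?a \<notin> directions (queried_zeros W ?a)" using W(2) a by (auto simp: exposed_def)
    \<comment> \<open>The two cores treat the bit differently exactly when \<open>j ?a\<close> is
      not in \<open>?Z\<close>. At a queried lower endpoint the bit must stay, which holds because
      the upper endpoint is not queried.\<close>
    have "(?a, ?E) \<in> flips W j \<longleftrightarrow> j ?a \<notin> ?Z"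
    proof (cases "j ?a \<in> ?Z")
      case True
      then have "?E = ?Z" by auto
      moreover have "?Z - {j ?a} \<notin> queried_zeros W ?a"
      proof
        assume "?Z - {j ?a} \<in> queried_zeros W ?a"
        moreover have "insert (j ?a) (?Z - {j ?a}) = ?Z" using True by auto
        ultimately have "j ?a \<in> directions (queried_zeros W ?a)"
          unfolding directions_def using Z by (intro CollectI bexI[of _ "?Z - {j ?a}"]) auto
        with no show False by simp
      qed
      ultimately show ?thesis using True by (auto simp: flips_def)
    next
      case False
      then show ?thesis using a E Z by (auto simp: flips_def)
    qed
    then show ?thesis by (auto simp: core_def)
  qed (simp add: core_def)
  then have "rule k True j C ?a ?Z \<sigma> \<tau> = rule k False j (sym_diff C (flips W j)) ?a ?Z \<sigma> \<tau>" for \<sigma> \<tau>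
    unfolding rule_def by (metis le_neq_implies_less)
  then show ?thesis unfolding hard_def by simp
qed

text \<open>Whatever the bits \<open>C\<close>, a sample with label \<open>a\<close> never excludes the members of its zero set as
  values of \<open>j a\<close>. With distinct labels, no other sample depends on \<open>j a\<close>.\<close>

lemma many_directions_consistent:
  assumes j: "j \<in> labels \<rightarrow>\<^sub>E M" and dist: "distinct (map (zeros P) xs)"
    and xs: "set xs \<subseteq> ones n (hard True j C)"
  shows "k - 1 \<le> card {i \<in> M. set xs \<subseteq> ones n (hard True (j(a := i)) C)}"
proof -
  have other: "x \<in> ones n (hard True (j(a := i)) C)" if "x \<in> set xs" "zeros P x \<noteq> a" for x i
    using xs that by (auto simp: ones_hard rule_def)
  have "\<exists>I\<subseteq>M. k - 1 \<le> card I \<and> (\<forall>i\<in>I. set xs \<subseteq> ones n (hard True (j(a := i)) C))"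
  proof (cases "\<exists>x\<in>set xs. zeros P x = a")
    case False
    then show ?thesis using other card_M by (intro exI[of _ M]) auto
  next
    case True
    then obtain x where x: "x \<in> set xs" "zeros P x = a" by blast
    have uniq: "y = x" if "y \<in> set xs" "zeros P y = a" for y
      using dist x that unfolding distinct_map by (auto dest: inj_onD)
    let ?Z = "zeros M x" and ?\<sigma> = "x (6 * k)" and ?c = "C `` {a}"
    have fin: "finite ?Z" by (simp add: finite_zeros)
    have x1: "x \<in> base" "rule k True j C a ?Z ?\<sigma> (x (6 * k + 1))" using x xs by (auto simp: ones_hard)
    have lift: "set xs \<subseteq> ones n (hard True (j(a := i)) C)"
      if "core k True (j a) ?c ?Z ?\<sigma> \<Longrightarrow> core k True i ?c ?Z ?\<sigma>" for i
    proof
      fix y assume y: "y \<in> set xs"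
      show "y \<in> ones n (hard True (j(a := i)) C)"
      proof (cases "zeros P y = a")
        case True
        then have "y = x" using uniq y by simp
        then show ?thesis using x1 x that by (auto simp: ones_hard rule_def)
      qed (use other y in blast)
    qed
    \<comment> \<open>The direction matters only if \<open>core\<close> holds at \<open>x\<close>
      with \<open>?Z\<close> of size \<open>k - 1\<close> or \<open>k\<close>; the smaller size is
      the origin of the bound \<open>k - 1\<close>.\<close>
    show ?thesis
    proof (cases "core k True (j a) ?c ?Z ?\<sigma> \<longrightarrow> card ?Z + 2 \<le> k")
      case True
      then show ?thesis using lift card_M by (intro exI[of _ M]) (auto simp: core_def)
    next
      case False
      then have c: "card ?Z + 1 = k \<or> card ?Z = k \<and> j a \<in> ?Z \<and> (?Z \<in> ?c \<longleftrightarrow> ?\<sigma>)"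
        using fin by (auto simp: core_def card_insert_if insert_absorb split: if_splits)
      then have "core k True i ?c ?Z ?\<sigma>" if "i \<in> ?Z" for i
        using that by (auto simp: core_def insert_absorb)
      then show ?thesis using lift c by (intro exI[of _ ?Z]) auto
    qed
  qed
  then obtain I where I: "I \<subseteq> M" "k - 1 \<le> card I" "\<forall>i\<in>I. set xs \<subseteq> ones n (hard True (j(a := i)) C)" by blast
  have "card I \<le> card {i \<in> M. set xs \<subseteq> ones n (hard True (j(a := i)) C)}"
    using I by (intro card_mono) auto
  with I show ?thesis by simp
qed

text \<open>Each point lies over one label, so the bounds from Bondy's theorem add up to at most
  \<open>card W\<close>.\<close>

lemma sum_card_directions_le:
  assumes "finite W"
  shows "(\<Sum>a\<in>labels. card (directions (queried_zeros W a))) \<le> card W"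
proof -
  have im: "queried_zeros W a = zeros M ` {w \<in> W. zeros P w = a}" for a
    by (auto simp: queried_zeros_def)
  have "(\<Sum>a\<in>labels. card (directions (queried_zeros W a))) \<le> (\<Sum>a\<in>labels. card {w \<in> W. zeros P w = a})"
  proof (rule sum_mono)
    fix a
    have "card (directions (queried_zeros W a)) \<le> card (queried_zeros W a)"
      using assms by (intro card_directions_le) (simp add: im)
    also have "\<dots> \<le> card {w \<in> W. zeros P w = a}" unfolding im using assms by (intro card_image_le) simp
    finally show "card (directions (queried_zeros W a)) \<le> card {w \<in> W. zeros P w = a}" .
  qed
  also have "\<dots> = card (\<Union>a\<in>labels. {w \<in> W. zeros P w = a})"
    using assms by (intro card_UN_disjoint[symmetric]) auto
  also have "\<dots> \<le> card W" using assms by (intro card_mono) auto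
  finally show ?thesis .
qed

text \<open>For fixed bits \<open>C\<close>, a union bound over the labels, resampling
  \<open>j a\<close> at each: given the samples, \<open>W\<close> is exposed with probability at
  most \<open>card W / (k - 1)\<close>.\<close>

lemma card_exposed_le:
  assumes W: "finite W" and dist: "distinct (map (zeros P) xs)"
  shows "(k - 1) * card {(j, C) \<in> params. exposed W j \<and> set xs \<subseteq> ones n (hard True j C)}
    \<le> card W * card {(j, C) \<in> params. set xs \<subseteq> ones n (hard True j C)}"
proof -
  let ?J = "labels \<rightarrow>\<^sub>E M" and ?Q = "\<lambda>C j. set xs \<subseteq> ones n (hard True j C)"
  let ?d = "\<lambda>a. directions (queried_zeros W a)"
  have finJ: "finite ?J" by (intro finite_PiE) auto
  have slice: "(k - 1) * card {j \<in> ?J. exposed W j \<and> ?Q C j} \<le> card W * card {j \<in> ?J. ?Q C j}" for C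
  proof -
    have "{j \<in> ?J. exposed W j \<and> ?Q C j} = (\<Union>a\<in>labels. {j \<in> ?J. j a \<in> ?d a \<and> ?Q C j})"
      by (auto simp: exposed_def)
    then have "card {j \<in> ?J. exposed W j \<and> ?Q C j} \<le> (\<Sum>a\<in>labels. card {j \<in> ?J. j a \<in> ?d a \<and> ?Q C j})"
      by (simp add: card_UN_le)
    then have "(k - 1) * card {j \<in> ?J. exposed W j \<and> ?Q C j}
        \<le> (\<Sum>a\<in>labels. (k - 1) * card {j \<in> ?J. j a \<in> ?d a \<and> ?Q C j})"
      by (simp add: sum_distrib_left[symmetric])
    also have "\<dots> \<le> (\<Sum>a\<in>labels. card (?d a) * card {j \<in> ?J. ?Q C j})"
    proof (intro sum_mono resample_count)
      show "?d a \<subseteq> M" for a by (auto simp: directions_def queried_zeros_def zeros_def)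
    qed (use many_directions_consistent dist in auto)
    also have "\<dots> \<le> card W * card {j \<in> ?J. ?Q C j}"
      unfolding sum_distrib_right[symmetric] by (intro mult_right_mono sum_card_directions_le W) simp
    finally show ?thesis .
  qed
  have split: "card {(j, C) \<in> params. R j C} = (\<Sum>C\<in>Pow (labels \<times> tops). card {j \<in> ?J. R j C})" for R
  proof -
    have "{(j, C) \<in> params. R j C} = prod.swap ` (Sigma (Pow (labels \<times> tops)) (\<lambda>C. {j \<in> ?J. R j C}))"
      by (auto simp: params_def image_iff)
    also have "card \<dots> = card (Sigma (Pow (labels \<times> tops)) (\<lambda>C. {j \<in> ?J. R j C}))"
      by (rule card_image) (auto simp: inj_on_def)
    finally show ?thesis using finJ by (subst (asm) card_SigmaI) auto
  qed
  show ?thesis unfolding split sum_distrib_left by (intro sum_mono slice)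
qed

text \<open>Non-adaptivity enters here: once \<open>xs\<close> is fixed, so is the query set.
  Flipping bits maps the unexposed accepting parameters of the monotone mixture injectively into
  those of the other one.\<close>

lemma card_accepting_params_le:
  assumes W: "set xs \<union> set (mem_queries D xs) \<subseteq> cube n"
    and dist: "distinct (map (zeros P) xs)"
    and q: "length xs + length (mem_queries D xs) \<le> q"
  shows "(k - 1) * card {(j, C) \<in> params. xs \<in> accepting_samples n D (hard True j C)}
    \<le> (k - 1) * card {(j, C) \<in> params. xs \<in> accepting_samples n D (hard False j C)}
      + q * card {(j, C) \<in> params. set xs \<subseteq> ones n (hard True j C)}"
proof -
  \<comment> \<open>The samples belong to \<open>?W\<close> as well, because they must remain ones
    after the flip.\<close>
  let ?W = "set xs \<union> set (mem_queries D xs)"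
  let ?G = "{(j, C) \<in> params. \<not> exposed ?W j \<and> xs \<in> accepting_samples n D (hard True j C)}"
  let ?B = "{(j, C) \<in> params. exposed ?W j \<and> set xs \<subseteq> ones n (hard True j C)}"
  let ?N = "{(j, C) \<in> params. xs \<in> accepting_samples n D (hard False j C)}"
  let ?O = "{(j, C) \<in> params. set xs \<subseteq> ones n (hard True j C)}"
  have fin: "finite {(j, C) \<in> params. R j C}" for R
    by (rule finite_subset[OF _ finite_sets(6)]) auto
  have "card ?G \<le> card ?N"
  proof (rule card_inj_on_le)
    show "inj_on (\<lambda>(j, C). (j, sym_diff C (flips ?W j))) ?G"
      \<comment> \<open>\<open>flips\<close> depends on \<open>j\<close> but not on
        \<open>C\<close>, so the map is an involution.\<close>
      by (rule inj_on_inverseI[where g = "\<lambda>(j, C). (j, sym_diff C (flips ?W j))"]) auto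
    show "(\<lambda>(j, C). (j, sym_diff C (flips ?W j))) ` ?G \<subseteq> ?N"
    proof clarify
      fix j C assume jC: "(j, C) \<in> params" "\<not> exposed ?W j" and acc: "xs \<in> accepting_samples n D (hard True j C)"
      then have j: "j \<in> labels \<rightarrow>\<^sub>E M" by (simp add: params_def)
      have "sym_diff C (flips ?W j) \<subseteq> labels \<times> tops" using jC by (auto simp: params_def flips_def)
      then have par: "(j, sym_diff C (flips ?W j)) \<in> params" using j by (simp add: params_def)
      have eq: "hard True j C w = hard False j (sym_diff C (flips ?W j)) w" if "w \<in> ?W" for w
        using hard_eq_flipped[OF j W jC(2) that] .
      have answers: "map (hard True j C) (mem_queries D xs) = map (hard False j (sym_diff C (flips ?W j))) (mem_queries D xs)"
        using eq by simp
      have "set xs \<subseteq> ones n (hard False j (sym_diff C (flips ?W j)))"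
        using acc eq by (auto simp: accepting_samples_def ones_def)
      then show "(j, sym_diff C (flips ?W j)) \<in> params
          \<and> xs \<in> accepting_samples n D (hard False j (sym_diff C (flips ?W j)))"
        using acc par unfolding accepting_samples_def mem_Collect_eq answers by blast
    qed
  qed (rule fin)
  moreover have "card {(j, C) \<in> params. xs \<in> accepting_samples n D (hard True j C)} \<le> card (?G \<union> ?B)"
    by (intro card_mono finite_UnI fin) (auto simp: accepting_samples_def)
  moreover have "card (?G \<union> ?B) \<le> card ?G + card ?B" by (rule card_Un_le)
  ultimately have "card {(j, C) \<in> params. xs \<in> accepting_samples n D (hard True j C)} \<le> card ?N + card ?B"
    by linarith
  then have "(k - 1) * card {(j, C) \<in> params. xs \<in> accepting_samples n D (hard True j C)}
      \<le> (k - 1) * card ?N + (k - 1) * card ?B"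
    unfolding distrib_left[symmetric] by (rule mult_le_mono2)
  also have "(k - 1) * card ?B \<le> card ?W * card ?O" by (rule card_exposed_le) (use dist in auto)
  also have "card ?W \<le> q"
    using q card_Un_le[of "set xs" "set (mem_queries D xs)"] card_length[of xs] card_length[of "mem_queries D xs"]
    by linarith
  finally show ?thesis by simp
qed

text \<open>Summing over sample lists first allows a comparison list by list. The error
  \<open>q / (k - 1)\<close> comes from exposure, the other one from lists with repeated
  labels.\<close>

lemma advantage_le:
  fixes K :: nat
  assumes q: "\<And>xs. length xs = num_samples D \<Longrightarrow> set xs \<subseteq> cube n \<Longrightarrow>
      set (mem_queries D xs) \<subseteq> cube n \<and> num_samples D + length (mem_queries D xs) \<le> q"
    and K: "\<And>j C. (j, C) \<in> params \<Longrightarrow> card (ones n (hard True j C)) = K" "K > 0"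
  shows "(\<Sum>(j, C)\<in>params. real (card (accepting_samples n D (hard True j C))))
    \<le> (\<Sum>(j, C)\<in>params. real (card (accepting_samples n D (hard False j C))))
      + (real q / real (k - 1) + (real q)\<^sup>2 * real (6 * card tops * 2 ^ r) / real K) * (real (card params) * real K ^ num_samples D)"
proof -
  let ?s = "num_samples D" and ?B = "6 * card tops * 2 ^ r"
  \<comment> \<open>Lists over the whole cube form an index set independent of the instance, so the
    sums can be swapped.\<close>
  let ?L = "{xs. set xs \<subseteq> cube n \<and> length xs = ?s}"
  have finL: "finite ?L" by (rule finite_lists_length_eq[OF finite_cube])
  let ?c = "\<lambda>R xs. real (card {\<omega> \<in> params. R \<omega> xs})"
  let ?Y = "\<lambda>(j, C) xs. xs \<in> accepting_samples n D (hard True j C)"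
  let ?X = "\<lambda>(j, C) xs. xs \<in> accepting_samples n D (hard False j C)"
  let ?O = "\<lambda>(j, C) xs. set xs \<subseteq> ones n (hard True j C)"
  let ?R = "\<lambda>\<omega> xs. ?O \<omega> xs \<and> \<not> distinct (map (zeros P) xs)"
  have swap: "(\<Sum>xs\<in>?L. ?c R xs) = (\<Sum>\<omega>\<in>params. real (card {xs \<in> ?L. R \<omega> xs}))" for R
    using sum_card_swap[OF finL finite_sets(6), of "\<lambda>xs \<omega>. R \<omega> xs"]
    by (simp add: of_nat_sum[symmetric] del: of_nat_sum)
  have acc: "{xs \<in> ?L. xs \<in> accepting_samples n D f} = accepting_samples n D f" for f
    by (auto simp: accepting_samples_def ones_def)
  have all: "{xs \<in> ?L. set xs \<subseteq> ones n f} = {xs. set xs \<subseteq> ones n f \<and> length xs = ?s}" for f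
    by (auto simp: ones_def)
  have pairs: "{(j, C) \<in> params. R j C} = {\<omega> \<in> params. case \<omega> of (j, C) \<Rightarrow> R j C}" for R
    by auto
  have ineq: "?c ?Y xs \<le> ?c ?X xs + real q / real (k - 1) * ?c ?O xs + ?c ?R xs" if "xs \<in> ?L" for xs
  proof (cases "distinct (map (zeros P) xs)")
    case True
    have "(k - 1) * card {(j, C) \<in> params. xs \<in> accepting_samples n D (hard True j C)}
        \<le> (k - 1) * card {(j, C) \<in> params. xs \<in> accepting_samples n D (hard False j C)}
          + q * card {(j, C) \<in> params. set xs \<subseteq> ones n (hard True j C)}"
      using q[of xs] that by (intro card_accepting_params_le True) auto
    from this[unfolded pairs] have "real (k - 1) * ?c ?Y xs \<le> real (k - 1) * ?c ?X xs + real q * ?c ?O xs"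
      by (simp only: of_nat_mult[symmetric] of_nat_add[symmetric] of_nat_le_iff case_prod_unfold)
    moreover have "real (k - 1) > 0" using k by simp
    ultimately have "?c ?Y xs \<le> ?c ?X xs + real q / real (k - 1) * ?c ?O xs"
      by (simp add: field_simps)
    then show ?thesis by (simp add: True)
  next
    case False
    have "?c ?Y xs \<le> ?c ?R xs"
      using False by (intro of_nat_mono card_mono) (auto simp: accepting_samples_def)
    also have "\<dots> \<le> (?c ?X xs + real q / real (k - 1) * ?c ?O xs) + ?c ?R xs"
      by (rule add_increasing) simp_all
    finally show ?thesis .
  qed
  have "(\<Sum>(j, C)\<in>params. real (card (accepting_samples n D (hard True j C)))) = (\<Sum>xs\<in>?L. ?c ?Y xs)"
    unfolding swap by (simp only: acc case_prod_unfold)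
  also have "\<dots> \<le> (\<Sum>xs\<in>?L. ?c ?X xs + real q / real (k - 1) * ?c ?O xs + ?c ?R xs)"
    by (intro sum_mono ineq)
  also have "\<dots> = (\<Sum>xs\<in>?L. ?c ?X xs) + real q / real (k - 1) * (\<Sum>xs\<in>?L. ?c ?O xs) + (\<Sum>xs\<in>?L. ?c ?R xs)"
    by (simp only: sum.distrib sum_distrib_left)
  also have "(\<Sum>xs\<in>?L. ?c ?X xs) = (\<Sum>(j, C)\<in>params. real (card (accepting_samples n D (hard False j C))))"
    unfolding swap by (simp only: acc case_prod_unfold)
  also have "(\<Sum>xs\<in>?L. ?c ?O xs) = (\<Sum>\<omega>\<in>params. real K ^ ?s)"
    unfolding swap
  proof (rule sum.cong[OF refl])
    fix \<omega> assume \<omega>: "\<omega> \<in> params"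
    obtain j C where jC: "\<omega> = (j, C)" by fastforce
    show "real (card {xs \<in> ?L. ?O \<omega> xs}) = real K ^ ?s"
      unfolding jC prod.case all card_lists_length_eq[OF finite_ones] using K(1) \<omega> jC by simp
  qed
  also have "(\<Sum>xs\<in>?L. ?c ?R xs) \<le> (\<Sum>\<omega>\<in>params. (real q)\<^sup>2 * real ?B / real K * real K ^ ?s)"
    unfolding swap
  proof (rule sum_mono)
    fix \<omega> assume \<omega>: "\<omega> \<in> params"
    obtain j C where jC: "\<omega> = (j, C)" by fastforce
    let ?S = "ones n (hard True j C)"
    have eq: "{xs \<in> ?L. ?R \<omega> xs} = {xs. length xs = ?s \<and> set xs \<subseteq> ?S \<and> \<not> distinct (map (zeros P) xs)}"
      by (auto simp: jC ones_def)
    \<comment> \<open>The query bound speaks about valid sample lists only; a constant list of a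
      single one of the function yields \<open>?s \<le> q\<close>.\<close>
    have "card ?S = K" using K(1) \<omega> jC by simp
    with K(2) have "?S \<noteq> {}" by auto
    then obtain x where "x \<in> ?S" by blast
    then have "x \<in> cube n" by (simp add: ones_def)
    then have "set (replicate ?s x) \<subseteq> cube n" by auto
    from q[OF length_replicate this] have "?s \<le> q" by linarith
    then have "?s\<^sup>2 * ?B * K ^ ?s \<le> q\<^sup>2 * ?B * K ^ ?s" by (intro mult_right_mono power_mono) auto
    with card_repeated_labels_le[OF finite_ones \<open>card ?S = K\<close> card_label_fibre_le, of ?s]
    have "card {xs \<in> ?L. ?R \<omega> xs} * K \<le> q\<^sup>2 * ?B * K ^ ?s" unfolding eq by linarith
    then have "real (card {xs \<in> ?L. ?R \<omega> xs}) * real K \<le> (real q)\<^sup>2 * real ?B * real K ^ ?s"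
      by (simp only: of_nat_mult[symmetric] of_nat_power[symmetric] of_nat_le_iff)
    then show "real (card {xs \<in> ?L. ?R \<omega> xs}) \<le> (real q)\<^sup>2 * real ?B / real K * real K ^ ?s"
      using K(2) by (simp add: pos_le_divide_eq)
  qed
  finally show ?thesis by (simp add: algebra_simps)
qed

section \<open>The lower bound on queries in terms of \<open>k\<close>\<close>

lemma queries_lower_bound:
  assumes queries: "makes_queries_le n A q" and tests: "tests_monotonicity n F (1 / 36) A"
    and F: "\<And>b j C. j \<in> labels \<rightarrow>\<^sub>E M \<Longrightarrow> hard b j C \<in> F"
  shows "real k < 8 * real q"
proof (rule ccontr)
  assume "\<not> ?thesis"
  \<comment> \<open>The exposure error is then at most 1/4, as \<open>k - 1\<close> is at least
    \<open>k / 2\<close>, and the label error at most 1/16, as \<open>card labels\<close> is at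
    least \<open>2 * k\<^sup>2\<close>. Their sum 5/16 is below the advantage 1/3 from Yao's
    principle.\<close>
  then have small: "8 * real q \<le> real k" by simp
  define j0 where "j0 = (\<lambda>a\<in>labels. 0::nat)"
  define K where "K = card (ones n (hard True j0 {}))"
  have j0: "j0 \<in> labels \<rightarrow>\<^sub>E M" using k by (auto simp: j0_def M_def)
  have K: "card (ones n (hard b j C)) = K" if "j \<in> labels \<rightarrow>\<^sub>E M" for b j C
    unfolding K_def by (rule card_ones_hard_const[OF that j0])
  have pos: "card labels > 0" "card tops > 0" using k by (simp_all add: card_labels card_tops)
  have Kge: "card labels * card tops * 2 ^ r \<le> K" unfolding K_def by (rule card_ones_hard_ge)
  then have K0: "K > 0" using pos by (metis less_le_trans mult_pos_pos zero_less_numeral zero_less_power)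
  have yes: "card (ones n (case \<omega> of (j, C) \<Rightarrow> hard True j C)) = K
      \<and> pmf (verdict n (case \<omega> of (j, C) \<Rightarrow> hard True j C) A) True \<ge> 2 / 3" if "\<omega> \<in> params" for \<omega>
    using that tests F K hard_monotone unfolding tests_monotonicity_def params_def by (cases \<omega>) simp
  have no: "card (ones n (case \<omega> of (j, C) \<Rightarrow> hard False j C)) = K
      \<and> pmf (verdict n (case \<omega> of (j, C) \<Rightarrow> hard False j C) A) False \<ge> 2 / 3" if "\<omega> \<in> params" for \<omega>
    using that tests F K rel_dist_hard_False_ge unfolding tests_monotonicity_def params_def by (cases \<omega>) simp
  obtain D where D: "D \<in> set_pmf A" and
    adv: "(\<Sum>\<omega>\<in>params. real (card (accepting_samples n D (case \<omega> of (j, C) \<Rightarrow> hard True j C))))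
      \<ge> (\<Sum>\<omega>\<in>params. real (card (accepting_samples n D (case \<omega> of (j, C) \<Rightarrow> hard False j C))))
        + real (card params) / 3 * real K ^ num_samples D"
    by (rule exists_distinguishing_det_algorithm[OF finite_sets(6) yes no K0])
  let ?e = "real q / real (k - 1) + (real q)\<^sup>2 * real (6 * card tops * 2 ^ r) / real K"
  let ?T = "real (card params) * real K ^ num_samples D"
  have "(\<Sum>(j, C)\<in>params. real (card (accepting_samples n D (hard True j C))))
    \<le> (\<Sum>(j, C)\<in>params. real (card (accepting_samples n D (hard False j C)))) + ?e * ?T"
    by (rule advantage_le) (use queries D K K0 in \<open>auto simp: makes_queries_le_def params_def\<close>)
  from order_trans[OF adv[unfolded case_prod_unfold] this[unfolded case_prod_unfold]]
  have "real (card params) / 3 * real K ^ num_samples D \<le> ?e * ?T"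
    by (rule add_le_imp_le_left)
  moreover have "(j0, {}) \<in> params" using j0 by (simp add: params_def)
  then have "card params > 0" using finite_sets(6) by (auto simp: card_gt_0_iff)
  then have T: "?T > 0" using K0 by simp
  ultimately have "1 / 3 * ?T \<le> ?e * ?T" by simp
  then have e: "1 / 3 \<le> ?e" using T by (simp only: mult_le_cancel_right_pos)
  have "real q / real (k - 1) \<le> 1 / 4"
    using small k by (simp add: field_simps of_nat_diff)
  moreover have "(real q)\<^sup>2 * real (6 * card tops * 2 ^ r) / real K \<le> 1 / 16"
  proof -
    have "2 * k\<^sup>2 \<le> card labels"
      unfolding card_labels choose_two using k by (auto simp: power2_eq_square less_eq_div_iff_mult_less_eq)
    then have l: "2 * (real k)\<^sup>2 \<le> real (card labels)" by (metis of_nat_le_iff of_nat_mult of_nat_numeral of_nat_power)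
    have "(8 * real q)\<^sup>2 \<le> (real k)\<^sup>2" using small by (intro power_mono) auto
    then have q: "64 * (real q)\<^sup>2 \<le> (real k)\<^sup>2" by (simp add: power_mult_distrib)
    have "96 * (real q)\<^sup>2 \<le> real (card labels)" using q l by linarith
    then have "96 * (real q)\<^sup>2 * (real (card tops) * 2 ^ r) \<le> real (card labels) * (real (card tops) * 2 ^ r)"
      by (rule mult_right_mono) simp
    also have "\<dots> \<le> real K" 
      using Kge[folded of_nat_le_iff[where 'a = real]] by (simp add: mult.assoc)
    finally show ?thesis using K0 by (simp add: field_simps)
  qed
  ultimately have "?e \<le> 1 / 4 + 1 / 16" by (rule add_mono)
  from order_trans[OF e this] show False by simp
qed

end

section \<open>Choice of the parameters for given \<open>n\<close> and \<open>N\<close>\<close>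

lemma exists_scale:
  fixes G N :: nat
  assumes "0 < G" "G \<le> N"
  shows "\<exists>r. 2 ^ r * G \<le> N \<and> N < 2 * (2 ^ r * G)"
  using assms(2)
proof (induction N rule: less_induct)
  case (less N)
  show ?case
  proof (cases "N < 2 * G")
    case True
    with less.prems show ?thesis by (intro exI[of _ 0]) simp
  next
    case False
    then have "N div 2 < N" "G \<le> N div 2" using assms(1) by auto
    from less.IH[OF this] obtain r where "2 ^ r * G \<le> N div 2" "N div 2 < 2 * (2 ^ r * G)" by blast
    then show ?thesis by (intro exI[of _ "Suc r"]) auto
  qed
qed

theorem theorem1p2:
  fixes \<alpha>\<^sub>0 :: real
  assumes "\<alpha>\<^sub>0 < 1"
  shows "\<exists>\<epsilon>\<^sub>0 > 0. \<exists>c\<^sub>1 c\<^sub>2 :: real. 0 < c\<^sub>1 \<and> c\<^sub>1 \<le> c\<^sub>2 \<and>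
    (\<exists>c > 0. \<exists>k N\<^sub>0 :: nat. \<forall>n N q :: nat. \<forall>A :: algorithm.
       N \<ge> N\<^sub>0 \<longrightarrow> real N \<le> 2 powr (\<alpha>\<^sub>0 * real n) \<longrightarrow>
       makes_queries_le n A q \<longrightarrow>
       tests_monotonicity n
         {f \<in> boolean_functions n.
            c\<^sub>1 * real N \<le> real (card (ones n f)) \<and> real (card (ones n f)) \<le> c\<^sub>2 * real N}
         \<epsilon>\<^sub>0 A \<longrightarrow>
       real q \<ge> c * log 2 (real N) / (log 2 (log 2 (real N))) ^ k)"
proof -
  \<comment> \<open>With \<open>k\<close> at most \<open>\<beta> * L\<close>, the instance fits:
    \<open>r \<le> L \<le> \<alpha>\<^sub>0 * n\<close>, while \<open>6 * k + 2\<close> is at most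
    \<open>12 * \<beta> * L\<close> and hence at most
    \<open>(1 - \<alpha>\<^sub>0) * n\<close>.\<close>
  define \<beta> where "\<beta> = (1 - \<alpha>\<^sub>0) / 12"
  have \<beta>: "\<beta> > 0" using assms by (simp add: \<beta>_def)
  \<comment> \<open>This threshold ensures \<open>\<beta> * L \<ge> 2\<close> and hence
    \<open>k \<ge> 2\<close>.\<close>
  define N0 where "N0 = (2::nat) ^ nat \<lceil>2 / \<beta>\<rceil>"
  have main: "real q \<ge> \<beta> / 16 * log 2 (real N)"
    if N: "N \<ge> N0" and Nn: "real N \<le> 2 powr (\<alpha>\<^sub>0 * real n)" and queries: "makes_queries_le n A q"
      and tests: "tests_monotonicity n
         {f \<in> boolean_functions n.
            1 / 2 * real N \<le> real (card (ones n f)) \<and> real (card (ones n f)) \<le> 12 * real N} (1 / 36) A"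
    for n N q :: nat and A
  proof -
    define L where "L = log 2 (real N)"
    have N0: "N > 0" using N by (metis N0_def gr0I le_zero_eq power_not_zero zero_neq_numeral)
    have "2 / \<beta> \<le> real (nat \<lceil>2 / \<beta>\<rceil>)" by linarith
    also have "\<dots> = log 2 (real N0)" by (simp add: N0_def log_nat_power)
    also have "\<dots> \<le> L"
    proof -
      have "N0 > 0" by (simp add: N0_def)
      with N show ?thesis by (simp add: L_def)
    qed
    finally have L\<beta>: "2 \<le> \<beta> * L" using \<beta> by (simp add: field_simps)
    then have L0: "L > 0" using \<beta> by (metis zero_less_mult_pos less_le_trans zero_less_numeral)
    have Ln: "L \<le> \<alpha>\<^sub>0 * real n"
      unfolding L_def using Nn N0 by (simp add: log_le_iff)
    \<comment> \<open>For \<open>\<alpha>\<^sub>0 \<le> 0\<close> the size bound would force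
      \<open>N \<le> 1\<close>, which the threshold excludes.\<close>
    then have \<alpha>: "\<alpha>\<^sub>0 > 0" using L0 by (smt (verit) mult_nonneg_nonneg mult_nonpos_nonneg of_nat_0_le_iff)
    have Ln': "L \<le> real n" using Ln assms by (smt (verit) mult_left_le_one_le of_nat_0_le_iff \<alpha>)
    define k where "k = nat \<lfloor>\<beta> * L\<rfloor>"
    have k_bounds: "real k \<le> \<beta> * L" "\<beta> * L < real k + 1" "2 \<le> k"
      using L\<beta> unfolding k_def by (linarith, linarith, linarith)
    define G where "G = ((3 * k) choose 2) * ((3 * k) choose k)"
    have G0: "G > 0" using k_bounds(3) by (simp add: G_def)
    have "G \<le> 2 ^ (3 * k) * 2 ^ (3 * k)" unfolding G_def by (intro mult_mono binomial_le_pow2) auto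
    then have "real G \<le> 2 ^ (6 * k)" by (simp add: power_add[symmetric])
    also have "\<dots> = 2 powr (6 * real k)" by (simp add: powr_realpow[symmetric])
    also have "\<dots> \<le> 2 powr L"
    proof -
      have "6 * \<beta> \<le> 1" using \<alpha> by (simp add: \<beta>_def)
      then have "6 * \<beta> * L \<le> 1 * L" using L0 by (intro mult_right_mono) auto
      then show ?thesis using k_bounds(1) by simp
    qed
    also have "\<dots> = real N" using N0 by (simp add: L_def)
    finally have "G \<le> N" by simp
    \<comment> \<open>Each free coordinate doubles the number of ones, so \<open>r\<close> of them
      bring \<open>2 ^ r * G\<close> within a factor 2 of \<open>N\<close>.\<close>
    from exists_scale[OF G0 this] obtain r where r: "2 ^ r * G \<le> N" "N < 2 * (2 ^ r * G)" by blast
    have "2 ^ r \<le> N" using r(1) G0 by (metis One_nat_def Suc_leI le_trans mult.right_neutral mult_le_mono2)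
    then have "real r \<le> L" unfolding L_def using N0
      by (metis le_log2_of_power)
    then have "6 * real k + 2 + real r \<le> real n"
    proof -
      have "6 * real k + 2 \<le> 12 * (\<beta> * L)" using k_bounds L\<beta> by linarith
      also have "\<dots> = (1 - \<alpha>\<^sub>0) * L" by (simp add: \<beta>_def)
      also have "\<dots> \<le> (1 - \<alpha>\<^sub>0) * real n" using Ln' assms by (intro mult_left_mono) auto
      finally show ?thesis using Ln \<open>real r \<le> L\<close> by (simp add: algebra_simps)
    qed
    then have dim: "6 * k + 2 + r \<le> n" by linarith
    interpret hidden_directions n k r by unfold_locales (use k_bounds dim in auto)
    have "real k < 8 * real q"
    proof (rule queries_lower_bound[OF queries tests])
      fix b j C
      \<comment> \<open>The promise constants combine the factor 2 from scaling with the factor 12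
        between the bounds on the number of ones.\<close>
      have "N < 2 * card (ones n (hard b j C))" "card (ones n (hard b j C)) \<le> 12 * N"
        using r card_ones_hard_ge[of b j C] card_ones_hard_le[of b j C]
        by (simp_all add: G_def card_labels card_tops mult.commute)
      then show "hard b j C \<in> {f \<in> boolean_functions n.
            1 / 2 * real N \<le> real (card (ones n f)) \<and> real (card (ones n f)) \<le> 12 * real N}"
        using hard_in_boolean_functions by simp
    qed
    \<comment> \<open>Rounding down costs at most a factor 2, which with the factor 8 gives the
      constant \<open>\<beta> / 16\<close>.\<close>
    moreover have "\<beta> * L \<le> 2 * real k" using k_bounds by linarith
    ultimately show ?thesis by (simp add: L_def)
  qed
  show ?thesis
    using main \<beta>
    by (intro exI[of _ "1 / 36"] conjI exI[of _ "1 / 2"] exI[of _ 12] exI[of _ "\<beta> / 16"] exI[of _ 0] exI[of _ N0])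
       auto
qed

end
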